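(* Let $F$ be a finite abelian group, $r \in \mathbb{N}$, and $G = F \times \mathbb{T}^r$, where $\mathbb{T}$ is the multiplicative group of complex numbers of modulus one. Let $K \subset \widehat{G}$. Then $K$ is strictly positive definite if and only if $K$ is ubiquitous.
   Context: For a compact abelian group $G$ with character group $\widehat{G}$ (here $\widehat{G} \cong \widehat{F} \times \mathbb{Z}^r$, where $m \in \mathbb{Z}^r$ acts on $\mathbb{T}^r$ by $z \mapsto z_1^{m_1}\cdots z_r^{m_r}$): a trigonometric polynomial on $\widehat{G}$ is a function of the form $\gamma \mapsto \sum_{i=1}^n c_i \gamma(x_i)$ with $n \in \mathbb{N}$, $x_1,\dots,x_n \in G$, $c_1,\dots,c_n \in \mathbb{C}$. A subset $K \subset \widehat{G}$ is called strictly positive definite if the only trigonometric polynomial on $\widehat{G}$ vanishing at every point of $K$ is the identically zero function. A subset $K \subset \widehat{G}$ is called ubiquitous if for every subgroup $H$ of $\widehat{G}$ of finite index and every $\gamma \in \widehat{G}$ the coset $\gamma H$ meets $K$. *)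

theory Defs
  imports Complex_Main "HOL-Algebra.Coset"
begin

text \<open>The finite abelian group F is a finite type 'f with additive abelian group structure.
  G = F x T^r; a point of T^r is z :: nat => complex with |z i| = 1 for i < r
  (and normalised z i = 1 for i >= r). The dual group is F^ x Z^r, with
  m :: nat => int supported in {..<r}.\<close>

definition characters :: "('f::ab_group_add \<Rightarrow> complex) set" where
  "characters = {\<chi>. (\<forall>x. norm (\<chi> x) = 1) \<and> (\<forall>x y. \<chi> (x + y) = \<chi> x * \<chi> y)}"

definition torus_pts :: "nat \<Rightarrow> (nat \<Rightarrow> complex) set" where
  "torus_pts r = {z. (\<forall>i<r. norm (z i) = 1) \<and> (\<forall>i\<ge>r. z i = 1)}"

definition G_pts :: "nat \<Rightarrow> ('f::ab_group_add \<times> (nat \<Rightarrow> complex)) set" where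
  "G_pts r = UNIV \<times> torus_pts r"

definition dual_carrier :: "nat \<Rightarrow> (('f::ab_group_add \<Rightarrow> complex) \<times> (nat \<Rightarrow> int)) set" where
  "dual_carrier r = characters \<times> {m. \<forall>i\<ge>r. m i = 0}"

definition dual_group :: "nat \<Rightarrow> (('f::ab_group_add \<Rightarrow> complex) \<times> (nat \<Rightarrow> int)) monoid" where
  "dual_group r = \<lparr> carrier = dual_carrier r,
      mult = (\<lambda>a b. ((\<lambda>x. fst a x * fst b x), (\<lambda>i. snd a i + snd b i))),
      one = ((\<lambda>_. 1), (\<lambda>_. 0)) \<rparr>"

definition char_eval :: "nat \<Rightarrow> (('f::ab_group_add \<Rightarrow> complex) \<times> (nat \<Rightarrow> int))
    \<Rightarrow> ('f \<times> (nat \<Rightarrow> complex)) \<Rightarrow> complex" where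
  "char_eval r \<gamma> x = fst \<gamma> (fst x) * (\<Prod>i<r. (snd x i) powi (snd \<gamma> i))"

definition trig_poly :: "nat \<Rightarrow> nat \<Rightarrow> (nat \<Rightarrow> 'f::ab_group_add \<times> (nat \<Rightarrow> complex))
    \<Rightarrow> (nat \<Rightarrow> complex) \<Rightarrow> ('f \<Rightarrow> complex) \<times> (nat \<Rightarrow> int) \<Rightarrow> complex" where
  "trig_poly r n x c \<gamma> = (\<Sum>i<n. c i * char_eval r \<gamma> (x i))"

definition strictly_pd :: "nat \<Rightarrow> (('f::ab_group_add \<Rightarrow> complex) \<times> (nat \<Rightarrow> int)) set \<Rightarrow> bool" where
  "strictly_pd r K \<longleftrightarrow>
     (\<forall>n x c. (\<forall>i<n. x i \<in> G_pts r) \<and> (\<forall>\<gamma>\<in>K. trig_poly r n x c \<gamma> = 0)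
        \<longrightarrow> (\<forall>\<gamma>\<in>dual_carrier r. trig_poly r n x c \<gamma> = 0))"

definition ubiquitous :: "nat \<Rightarrow> (('f::ab_group_add \<Rightarrow> complex) \<times> (nat \<Rightarrow> int)) set \<Rightarrow> bool" where
  "ubiquitous r K \<longleftrightarrow>
     (\<forall>H \<gamma>. subgroup H (dual_group r) \<and> finite (rcosets\<^bsub>dual_group r\<^esub> H) \<and> \<gamma> \<in> dual_carrier r
        \<longrightarrow> (\<gamma> <#\<^bsub>dual_group r\<^esub> H) \<inter> K \<noteq> {})"

end

theory Submission
  imports Defs "HOL-Algebra.Multiplicative_Group" "HOL-Computational_Algebra.Polynomial"
begin

text \<open>
  A subgroup of finite index contains \<open>1 \<times> (N\<int>)\<^sup>r\<close> for some \<open>N\<close>, and up to scaling the indicator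
  function of a coset of the latter is a trigonometric polynomial, by orthogonality of characters.
  Hence strictly positive definite sets are ubiquitous.

  Conversely, let a trigonometric polynomial take a value \<open>d \<noteq> 0\<close> at \<open>\<gamma>\<close>. On the elements with the
  same \<open>F\<close>-component as \<open>\<gamma>\<close> it is a finite sum \<open>\<Sum>\<^sub>i c\<^sub>i \<Prod>\<^sub>j z\<^sub>i\<^sub>j\<^bsup>m\<^sub>j\<^esup>\<close>. The ring generated by all \<open>c\<^sub>i\<close>,
  \<open>z\<^sub>i\<^sub>j\<close> and \<open>z\<^sub>i\<^sub>j\<^bsup>-1\<^esup>\<close> has a proper ideal of finite index modulo which \<open>d\<close> is a unit. Modulo that
  ideal the units \<open>z\<^sub>i\<^sub>j\<close> have finite order, so the polynomial is congruent to \<open>d\<close>, and in particular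
  nonzero, on a whole coset of a subgroup of finite index.

  The ideal is found by adjoining generators one at a time, from \<open>A\<close> to \<open>A[x]\<close>. For \<open>x\<close> transcendental
  over \<open>A\<close> and \<open>b = \<beta>(x)\<close>, one makes the leading coefficient of \<open>\<beta>\<close> a unit modulo \<open>I\<close> and passes to
  the ideal generated by \<open>I\<close> and \<open>x\<beta>(x) + 1\<close>, modulo which \<open>b\<close> has the inverse \<open>-x\<close>. For \<open>x\<close> algebraic,
  \<open>b\<close> divides some nonzero \<open>e \<in> A\<close>, and one makes \<open>e\<close> and the leading coefficient of a minimal
  polynomial of \<open>x\<close> units modulo \<open>I\<close>.
\<close>

section \<open>Ideals of finite index in finitely generated domains\<close>

locale unital_subring =
  fixes A :: "'a::idom set"
  assumes one_mem: "1 \<in> A"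
    and diff_mem: "\<And>a b. a \<in> A \<Longrightarrow> b \<in> A \<Longrightarrow> a - b \<in> A"
    and mult_mem: "\<And>a b. a \<in> A \<Longrightarrow> b \<in> A \<Longrightarrow> a * b \<in> A"
begin

lemma zero_mem: "0 \<in> A"
  using diff_mem[OF one_mem one_mem] by simp

lemma minus_mem: "a \<in> A \<Longrightarrow> - a \<in> A"
  using diff_mem[OF zero_mem] by simp

lemma add_mem: "a \<in> A \<Longrightarrow> b \<in> A \<Longrightarrow> a + b \<in> A"
  using diff_mem[OF _ minus_mem] by simp

lemma power_mem: "a \<in> A \<Longrightarrow> a ^ n \<in> A"
  by (induction n) (auto intro: one_mem mult_mem)

lemma sum_mem: "(\<And>i. i \<in> S \<Longrightarrow> f i \<in> A) \<Longrightarrow> sum f S \<in> A"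
  by (induction S rule: infinite_finite_induct) (auto intro: zero_mem add_mem)

lemma prod_mem: "(\<And>i. i \<in> S \<Longrightarrow> f i \<in> A) \<Longrightarrow> prod f S \<in> A"
  by (induction S rule: infinite_finite_induct) (auto intro: one_mem mult_mem)

end

text \<open>Rings are subsets of one fixed domain, because generators are adjoined repeatedly inside
  it. Polynomials over such a ring are therefore polynomials over the whole domain with restricted
  coefficients.\<close>

definition polys_over :: "'a::zero set \<Rightarrow> 'a poly set" where
  "polys_over A = {q. \<forall>i. coeff q i \<in> A}"

lemma polys_overI: "(\<And>i. coeff q i \<in> A) \<Longrightarrow> q \<in> polys_over A"
  and polys_overD: "q \<in> polys_over A \<Longrightarrow> coeff q i \<in> A"
  by (auto simp: polys_over_def)

definition adjoin :: "'a::comm_semiring_0 set \<Rightarrow> 'a \<Rightarrow> 'a set" where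
  "adjoin A x = (\<lambda>q. poly q x) ` polys_over A"

context unital_subring
begin

lemma const_polys_over: "a \<in> A \<Longrightarrow> [:a:] \<in> polys_over A"
  by (auto simp: polys_over_def coeff_pCons zero_mem split: nat.split)

lemma monom_polys_over: "a \<in> A \<Longrightarrow> monom a n \<in> polys_over A"
  by (auto simp: polys_over_def coeff_monom zero_mem)

lemma smult_polys_over: "a \<in> A \<Longrightarrow> q \<in> polys_over A \<Longrightarrow> smult a q \<in> polys_over A"
  by (auto simp: polys_over_def mult_mem)

lemma unital_subring_polys_over: "unital_subring (polys_over A)"
proof
  show "1 \<in> polys_over A"
    using const_polys_over[OF one_mem] by (simp add: one_pCons)
qed (auto simp: polys_over_def coeff_mult intro!: diff_mem sum_mem mult_mem)

lemmas polys_one_mem = unital_subring.one_mem[OF unital_subring_polys_over]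
  and polys_zero_mem = unital_subring.zero_mem[OF unital_subring_polys_over]
  and polys_add_mem = unital_subring.add_mem[OF unital_subring_polys_over]
  and polys_diff_mem = unital_subring.diff_mem[OF unital_subring_polys_over]
  and polys_mult_mem = unital_subring.mult_mem[OF unital_subring_polys_over]

lemma unital_subring_adjoin: "unital_subring (adjoin A x)"
proof
  show "1 \<in> adjoin A x"
    unfolding adjoin_def by (rule image_eqI[OF _ polys_one_mem]) simp
next
  fix a b assume "a \<in> adjoin A x" "b \<in> adjoin A x"
  then obtain p q where "p \<in> polys_over A" "q \<in> polys_over A" "a = poly p x" "b = poly q x"
    by (auto simp: adjoin_def)
  then have "a - b = poly (p - q) x" "a * b = poly (p * q) x" "p - q \<in> polys_over A"
    "p * q \<in> polys_over A"
    by (auto intro: polys_diff_mem polys_mult_mem)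
  then show "a - b \<in> adjoin A x" "a * b \<in> adjoin A x"
    unfolding adjoin_def by blast+
qed

lemma subset_adjoin: "A \<subseteq> adjoin A x"
proof
  fix a assume "a \<in> A"
  then show "a \<in> adjoin A x"
    unfolding adjoin_def by (intro image_eqI[OF _ const_polys_over]) auto
qed

lemma adjoin_generator: "x \<in> adjoin A x"
  unfolding adjoin_def
  by (rule image_eqI[OF _ monom_polys_over[OF one_mem, of 1]]) (simp add: poly_monom)

text \<open>Long division in which each cancellation first multiplies by
  \<open>lead_coeff g\<close>, as this coefficient need not be invertible in \<open>A\<close>. The
  exponent \<open>k\<close> counts the cancellations.\<close>

lemma pseudo_division:
  assumes g: "g \<in> polys_over A" "degree g > 0" and q: "q \<in> polys_over A"
  shows "\<exists>k. \<exists>h\<in>polys_over A. \<exists>s\<in>polys_over A.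
           smult (lead_coeff g ^ k) q = g * h + s \<and> degree s < degree g"
  using q
proof (induction "degree q" arbitrary: q rule: less_induct)
  case less
  let ?l = "lead_coeff g"
  show ?case
  proof (cases "degree q < degree g")
    case True
    then show ?thesis
      using less.prems polys_zero_mem by (intro exI[of _ 0] bexI[of _ 0] bexI[of _ q]) auto
  next
    case False
    define d where "d = degree q - degree g"
    define m where "m = monom (lead_coeff q) d"
    \<comment> \<open>Both terms have the coefficient \<open>lead_coeff g * lead_coeff q\<close> in
      degree \<open>degree q\<close>, so the leading term cancels.\<close>
    define q' where "q' = smult ?l q - g * m"
    have m: "m \<in> polys_over A"
      unfolding m_def using less.prems by (intro monom_polys_over polys_overD)
    have q': "q' \<in> polys_over A"
      unfolding q'_def using less.prems g m
      by (intro polys_diff_mem polys_mult_mem smult_polys_over polys_overD)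
    have "coeff q' i = 0" if "i \<ge> degree q" for i
    proof (cases "i = degree q")
      case True
      have "coeff (g * m) (degree g + d) = ?l * lead_coeff q"
        by (simp add: m_def mult.commute[of g] coeff_monom_mult)
      then show ?thesis
        using True False by (simp add: q'_def d_def)
    next
      case False
      have "degree (g * m) \<le> degree q"
        using degree_mult_le[of g m] degree_monom_le[of "lead_coeff q" d] \<open>\<not> degree q < degree g\<close>
        by (simp add: m_def d_def)
      then show ?thesis
        using False that by (simp add: q'_def coeff_eq_0)
    qed
    \<comment> \<open>The truncated subtraction is harmless: \<open>degree q\<close> is at least
      \<open>degree g\<close>, hence positive.\<close>
    then have "degree q' \<le> degree q - 1"
      by (intro degree_le) auto
    then have "degree q' < degree q"
      using False g(2) by linarith
    from less.hyps[OF this q'] obtain k h s where hs: "h \<in> polys_over A" "s \<in> polys_over A"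
      "smult (?l ^ k) q' = g * h + s" "degree s < degree g"
      by blast
    have "smult (?l ^ Suc k) q = g * (h + smult (?l ^ k) m) + s"
      using hs(3) by (simp add: q'_def smult_diff_right algebra_simps)
    moreover have "h + smult (?l ^ k) m \<in> polys_over A"
      using hs(1) m g by (intro polys_add_mem smult_polys_over power_mem polys_overD)
    ultimately show ?thesis
      using hs by blast
  qed
qed

end

section \<open>Ideals whose quotient ring is finite and nonzero\<close>

locale finite_index_ideal = unital_subring +
  fixes I
  assumes subset: "I \<subseteq> A"
    and zero_ideal: "0 \<in> I"
    and add_ideal: "\<And>a b. a \<in> I \<Longrightarrow> b \<in> I \<Longrightarrow> a + b \<in> I"
    and mult_ideal: "\<And>a b. a \<in> A \<Longrightarrow> b \<in> I \<Longrightarrow> a * b \<in> I"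
    and proper: "1 \<notin> I"
    and finite_index: "\<exists>T. finite T \<and> (\<forall>a\<in>A. \<exists>t\<in>T. a - t \<in> I)"
begin

lemma minus_ideal: "a \<in> I \<Longrightarrow> - a \<in> I"
  using mult_ideal[OF minus_mem[OF one_mem]] by simp

lemma diff_ideal: "a \<in> I \<Longrightarrow> b \<in> I \<Longrightarrow> a - b \<in> I"
  using add_ideal[OF _ minus_ideal] by simp

lemma mult_ideal_right: "a \<in> I \<Longrightarrow> b \<in> A \<Longrightarrow> a * b \<in> I"
  using mult_ideal[of b a] by (simp add: mult.commute)

lemma sum_ideal: "(\<And>i. i \<in> S \<Longrightarrow> f i \<in> I) \<Longrightarrow> sum f S \<in> I"
  by (induction S rule: infinite_finite_induct) (auto intro: zero_ideal add_ideal)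

lemma mult_cong:
  assumes "a - a' \<in> I" "b - b' \<in> I" "a' \<in> A" "b \<in> A"
  shows "a * b - a' * b' \<in> I"
proof -
  have "a * b - a' * b' = (a - a') * b + a' * (b - b')"
    by (simp add: algebra_simps)
  then show ?thesis
    using assms by (simp add: add_ideal mult_ideal mult_ideal_right)
qed

lemma power_cong_one:
  assumes "1 - a \<in> I" "a \<in> A"
  shows "1 - a ^ k \<in> I"
proof (induction k)
  case (Suc k)
  show ?case
    using mult_cong[OF assms(1) Suc assms(2) one_mem] by simp
qed (simp add: zero_ideal)

lemma unit_not_ideal:
  assumes "1 - a * u \<in> I" "u \<in> A"
  shows "a \<notin> I"
  using add_ideal[OF assms(1) mult_ideal_right[OF _ assms(2)], of a] proper by auto

lemma unit_cancel:
  assumes "1 - a * u \<in> I" "u \<in> A" "b \<in> A" "a * b \<in> I"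
  shows "b \<in> I"
proof -
  have "b = (1 - a * u) * b + u * (a * b)"
    by (simp add: algebra_simps)
  then show ?thesis
    using assms by (metis add_ideal mult_ideal mult_ideal_right)
qed

lemma polys_zero_ideal: "0 \<in> polys_over I"
  by (simp add: polys_over_def zero_ideal)

lemma polys_over_ideal_mult:
  assumes "p \<in> polys_over A" "q \<in> polys_over I"
  shows "p * q \<in> polys_over I"
  using assms by (auto simp: polys_over_def coeff_mult intro!: sum_ideal mult_ideal)

lemma polys_over_ideal_add:
  assumes "p \<in> polys_over I" "q \<in> polys_over I"
  shows "p + q \<in> polys_over I"
  using assms by (auto simp: polys_over_def intro: add_ideal)

lemma polys_over_ideal_subset: "polys_over I \<subseteq> polys_over A"
  using subset by (auto simp: polys_over_def)

text \<open>A polynomial whose leading coefficient is a unit modulo \<open>I\<close> behaves modulo \<open>I\<close> like a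
  monic one: multiplying by it raises degrees.\<close>

lemma cofactor_in_ideal:
  assumes g: "g \<in> polys_over A" and h: "h \<in> polys_over A"
    and u: "1 - lead_coeff g * u \<in> I" "u \<in> A"
    and high: "\<And>i. i \<ge> degree g \<Longrightarrow> coeff (g * h) i \<in> I"
  shows "h \<in> polys_over I"
proof (rule polys_overI)
  fix k
  show "coeff h k \<in> I"
  \<comment> \<open>Downward induction on \<open>k\<close>. The \<open>Suc\<close> makes the measure
    drop also from \<open>k = degree h\<close> to larger indices, where the coefficients
    vanish.\<close>
  proof (induction "Suc (degree h) - k" arbitrary: k rule: less_induct)
    case less
    show ?case
    proof (cases "k > degree h")
      case True
      then show ?thesis
        by (simp add: coeff_eq_0 zero_ideal)
    next
      case False
      let ?n = "degree g"
      have later: "coeff h j \<in> I" if "j > k" for j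
        using less[of j] that False by simp
      have "coeff (g * h) (?n + k) = (\<Sum>i\<le>?n + k. coeff g i * coeff h (?n + k - i))"
        by (rule coeff_mult)
      also have "\<dots> = lead_coeff g * coeff h k
          + (\<Sum>i\<in>{..?n + k} - {?n}. coeff g i * coeff h (?n + k - i))"
        by (subst sum.remove[of _ ?n]) auto
      finally have "lead_coeff g * coeff h k = coeff (g * h) (?n + k)
          - (\<Sum>i\<in>{..?n + k} - {?n}. coeff g i * coeff h (?n + k - i))"
        by simp
      also have "\<dots> \<in> I"
      proof (intro diff_ideal sum_ideal)
        show "coeff (g * h) (?n + k) \<in> I"
          by (rule high) simp
        fix i assume i: "i \<in> {..?n + k} - {?n}"
        show "coeff g i * coeff h (?n + k - i) \<in> I"
        proof (cases "i < ?n")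
          case True
          then show ?thesis
            by (intro mult_ideal polys_overD[OF g] later) simp
        next
          case False
          then show ?thesis
            using i by (simp add: coeff_eq_0 zero_ideal)
        qed
      qed
      finally show ?thesis
        using unit_cancel[OF u polys_overD[OF h]] by blast
    qed
  qed
qed

text \<open>Multiplying a pseudo-division by \<open>u ^ k\<close> turns the factor of
  \<open>q\<close> into a power of \<open>lead_coeff g * u\<close>, which is 1 modulo
  \<open>I\<close>. The resulting error, a multiple of \<open>q\<close> by an element of
  \<open>I\<close>, is the summand \<open>i\<close>.\<close>

lemma division_mod_ideal:
  assumes g: "g \<in> polys_over A" "degree g > 0" and q: "q \<in> polys_over A"
    and u: "1 - lead_coeff g * u \<in> I" "u \<in> A"
  shows "\<exists>h\<in>polys_over A. \<exists>i\<in>polys_over I. \<exists>s\<in>polys_over A.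
           q = g * h + i + s \<and> degree s < degree g"
proof -
  let ?l = "lead_coeff g"
  have l: "?l \<in> A"
    using g(1) by (rule polys_overD)
  obtain k h s where hs: "h \<in> polys_over A" "s \<in> polys_over A"
    "smult (?l ^ k) q = g * h + s" "degree s < degree g"
    using pseudo_division[OF g q] by blast
  define e where "e = 1 - (?l * u) ^ k"
  have e: "e \<in> I"
    unfolding e_def using u l by (intro power_cong_one mult_mem)
  have "smult (u ^ k) (smult (?l ^ k) q) = g * smult (u ^ k) h + smult (u ^ k) s"
    by (simp add: hs(3) smult_add_right)
  then have "smult (1 - e) q = g * smult (u ^ k) h + smult (u ^ k) s"
    by (simp add: e_def power_mult_distrib mult.commute)
  then have "q = g * smult (u ^ k) h + smult e q + smult (u ^ k) s"
    by (simp add: smult_diff_left algebra_simps)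
  moreover have "smult e q \<in> polys_over I"
    using e q by (auto simp: polys_over_def intro: mult_ideal_right)
  moreover have "smult (u ^ k) h \<in> polys_over A" "smult (u ^ k) s \<in> polys_over A"
    using hs u by (auto intro: smult_polys_over power_mem)
  moreover have "degree (smult (u ^ k) s) < degree g"
    using hs(4) by (meson degree_smult_le le_less_trans)
  ultimately show ?thesis
    by blast
qed

text \<open>\<open>J\<close> is the image in \<open>A[x]\<close> of the ideal generated by
  \<open>g\<close> and \<open>I\<close>. Division by \<open>g\<close> leaves remainders of degree
  below \<open>degree g\<close>, whose coefficients matter only modulo \<open>I\<close>; this gives
  finite index. For properness, \<open>vanish\<close> lifts an equation 1 = (element of
  \<open>J\<close>) from \<open>A[x]\<close> to polynomials, where \<open>cofactor_in_ideal\<close>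
  refutes it. The hypothesis \<open>vanish\<close> is phrased to cover both a transcendental
  \<open>x\<close> and a \<open>g\<close> of least degree vanishing at \<open>x\<close>.\<close>

lemma finite_index_ideal_adjoin:
  assumes g: "g \<in> polys_over A" "degree g > 0"
    and u: "1 - lead_coeff g * u \<in> I" "u \<in> A"
    and vanish: "\<And>q. q \<in> polys_over A \<Longrightarrow> poly q x = 0 \<Longrightarrow>
      \<exists>k. \<exists>h\<in>polys_over A. smult (lead_coeff g ^ k) q = g * h"
  defines "J \<equiv> {poly (g * h + i) x | h i. h \<in> polys_over A \<and> i \<in> polys_over I}"
  shows "finite_index_ideal (adjoin A x) J"
proof -
  interpret B: unital_subring "adjoin A x"
    by (rule unital_subring_adjoin)
  let ?l = "lead_coeff g"
  have l: "?l \<in> A"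
    using g(1) by (rule polys_overD)
  have J: "poly (g * h + i) x \<in> J" if "h \<in> polys_over A" "i \<in> polys_over I" for h i
    using that by (auto simp: J_def)
  have JI: "poly i x \<in> J" if "i \<in> polys_over I" for i
    using J[OF polys_zero_mem that] by simp
  have J_add: "a + b \<in> J" if "a \<in> J" "b \<in> J" for a b
  proof -
    from that obtain h i h' i' where ab: "a = poly (g * h + i) x" "b = poly (g * h' + i') x"
      and P: "h \<in> polys_over A" "i \<in> polys_over I" "h' \<in> polys_over A" "i' \<in> polys_over I"
      by (auto simp: J_def)
    have "a + b = poly (g * (h + h') + (i + i')) x"
      by (simp add: ab algebra_simps)
    then show ?thesis
      using P by (metis J polys_add_mem polys_over_ideal_add)
  qed
  obtain T where T: "finite T" "\<And>a. a \<in> A \<Longrightarrow> \<exists>t\<in>T. a - t \<in> I"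
    using finite_index by blast
  define rep where "rep a = (SOME t. t \<in> T \<and> a - t \<in> I)" for a
  have rep: "rep a \<in> T" "a - rep a \<in> I" if "a \<in> A" for a
    using T(2)[OF that] someI_ex[of "\<lambda>t. t \<in> T \<and> a - t \<in> I"] by (auto simp: rep_def)
  let ?n = "degree g"
  define S where "S = (\<lambda>f. \<Sum>j<?n. f j * x ^ j) ` ({..<?n} \<rightarrow>\<^sub>E T)"
  have cover: "\<exists>t\<in>S. a - t \<in> J" if "a \<in> adjoin A x" for a
  proof -
    from that obtain q where q: "q \<in> polys_over A" "a = poly q x"
      by (auto simp: adjoin_def)
    obtain h i s where his: "h \<in> polys_over A" "i \<in> polys_over I" "s \<in> polys_over A"
      "q = g * h + i + s" "degree s < ?n"
      using division_mod_ideal[OF g q(1) u] by blast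
    define f where "f = (\<lambda>j\<in>{..<?n}. rep (coeff s j))"
    define t where "t = (\<Sum>j<?n. f j * x ^ j)"
    \<comment> \<open>The error made by replacing each coefficient of the remainder \<open>s\<close>
      by its representative in \<open>T\<close>.\<close>
    define e where "e = (\<Sum>j<?n. monom (coeff s j - f j) j)"
    have e: "e \<in> polys_over I"
    proof (rule polys_overI)
      fix j
      have "coeff e j = (if j < ?n then coeff s j - f j else 0)"
        by (simp add: e_def coeff_sum coeff_monom sum.delta)
      then show "coeff e j \<in> I"
        using rep(2)[OF polys_overD[OF his(3)], of j] by (simp add: f_def zero_ideal)
    qed
    have "poly s x = (\<Sum>j<?n. coeff s j * x ^ j)"
      unfolding poly_altdef using his(5)
      by (intro sum.mono_neutral_left) (auto simp: coeff_eq_0)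
    then have "poly e x = poly s x - t"
      by (simp add: e_def t_def poly_sum poly_monom sum_subtractf left_diff_distrib)
    then have "a - t = poly (g * h + (i + e)) x"
      by (simp add: q(2) his(4))
    then have "a - t \<in> J"
      using his e by (metis J polys_over_ideal_add)
    moreover have "f \<in> {..<?n} \<rightarrow>\<^sub>E T"
      unfolding f_def using rep(1)[OF polys_overD[OF his(3)]] by auto
    ultimately show ?thesis
      by (auto simp: S_def t_def)
  qed
  show ?thesis
  proof unfold_locales
    show "J \<subseteq> adjoin A x"
      using g(1) polys_over_ideal_subset
      by (auto simp: J_def adjoin_def simp del: poly_add poly_mult
          intro!: imageI polys_add_mem polys_mult_mem)
    show "0 \<in> J"
      using JI[OF polys_zero_ideal] by simp
    show "a + b \<in> J" if "a \<in> J" "b \<in> J" for a b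
      using that by (rule J_add)
    show "a * b \<in> J" if a: "a \<in> adjoin A x" and b: "b \<in> J" for a b
    proof -
      from a b obtain p h i where P: "p \<in> polys_over A" "h \<in> polys_over A" "i \<in> polys_over I"
        and ab: "a = poly p x" "b = poly (g * h + i) x"
        by (auto simp: J_def adjoin_def)
      have "a * b = poly (g * (p * h) + p * i) x"
        by (simp add: ab algebra_simps)
      then show ?thesis
        using P by (metis J polys_mult_mem polys_over_ideal_mult)
    qed
    show "\<exists>T. finite T \<and> (\<forall>a\<in>adjoin A x. \<exists>t\<in>T. a - t \<in> J)"
      using cover T(1) by (intro exI[of _ S]) (auto simp: S_def intro!: finite_PiE)
    show "1 \<notin> J"
    proof
      assume "1 \<in> J"
      then obtain h i where hi: "h \<in> polys_over A" "i \<in> polys_over I" "1 = poly (g * h + i) x"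
        by (auto simp: J_def)
      have iA: "i \<in> polys_over A"
        using hi(2) polys_over_ideal_subset by blast
      have "1 - (g * h + i) \<in> polys_over A"
        using hi g(1) iA by (intro polys_diff_mem polys_add_mem polys_mult_mem polys_one_mem)
      moreover have "poly (1 - (g * h + i)) x = 0"
        using hi(3) by simp
      ultimately obtain k h' where h': "h' \<in> polys_over A"
        "smult (?l ^ k) (1 - (g * h + i)) = g * h'"
        using vanish by blast
      \<comment> \<open>Collecting the multiples of \<open>g\<close> leaves a constant minus an
        element of \<open>I[X]\<close>. Since \<open>degree g > 0\<close>, the constant does not
        appear in degrees \<open>\<ge> degree g\<close>, so \<open>cofactor_in_ideal\<close>
        applies.\<close>
      define h2 where "h2 = h' + smult (?l ^ k) h"
      have eq: "g * h2 = [:?l ^ k:] - smult (?l ^ k) i"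
        using h'(2) by (simp add: h2_def smult_diff_right smult_add_right algebra_simps one_pCons)
      have h2: "h2 \<in> polys_over A"
        unfolding h2_def using h'(1) hi(1) l by (intro polys_add_mem smult_polys_over power_mem)
      have li: "smult (?l ^ k) i \<in> polys_over I"
        using hi(2) power_mem[OF l] by (auto simp: polys_over_def intro: mult_ideal)
      have "h2 \<in> polys_over I"
      proof (rule cofactor_in_ideal[OF g(1) h2 u])
        fix j assume "j \<ge> ?n"
        then have "coeff (g * h2) j = - coeff (smult (?l ^ k) i) j"
          using g(2) by (simp add: eq coeff_pCons split: nat.split)
        then show "coeff (g * h2) j \<in> I"
          using minus_ideal[OF polys_overD[OF li]] by simp
      qed
      then have "coeff (g * h2 + smult (?l ^ k) i) 0 \<in> I"
        using g(1) li by (intro polys_overD polys_over_ideal_add polys_over_ideal_mult)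
      then have "?l ^ k \<in> I"
        by (simp add: eq)
      moreover have "1 - ?l ^ k * u ^ k \<in> I"
        using power_cong_one[OF u(1) mult_mem[OF l u(2)], of k] by (simp add: power_mult_distrib)
      ultimately show False
        using unit_not_ideal power_mem[OF u(2)] by blast
    qed
  qed
qed

end

section \<open>Making a nonzero element a unit modulo an ideal of finite index\<close>

definition residually_finite_units :: "'a::idom set \<Rightarrow> bool" where
  "residually_finite_units A \<longleftrightarrow>
     (\<forall>d\<in>A. d \<noteq> 0 \<longrightarrow> (\<exists>I. finite_index_ideal A I \<and> (\<exists>u\<in>A. 1 - d * u \<in> I)))"

lemma unital_subring_Ints: "unital_subring (\<int> :: 'a::idom set)"
  by unfold_locales auto

text \<open>Modulo \<open>\<bar>k\<bar> + 1\<close> the integer \<open>\<bar>k\<bar>\<close> is -1,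
  so \<open>- sgn k\<close> inverts \<open>k\<close>; the modulus is at least 2, so the ideal is
  proper.\<close>

lemma residually_finite_units_Ints: "residually_finite_units (\<int> :: 'a::{idom, ring_char_0} set)"
  unfolding residually_finite_units_def
proof (intro ballI impI)
  fix d :: 'a assume "d \<in> \<int>" "d \<noteq> 0"
  then obtain k where k: "d = of_int k" "k \<noteq> 0"
    by (auto elim: Ints_cases)
  define m where "m = \<bar>k\<bar> + 1"
  define I where "I = range (\<lambda>j. of_int (m * j) :: 'a)"
  have m: "m \<ge> 2"
    using k by (simp add: m_def)
  interpret unital_subring "\<int> :: 'a set"
    by (rule unital_subring_Ints)
  have "finite_index_ideal \<int> I"
  proof unfold_locales
    show "I \<subseteq> \<int>" "0 \<in> I"
      by (auto simp: I_def intro: range_eqI[of _ _ 0])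
    show "a + b \<in> I" if "a \<in> I" "b \<in> I" for a b
      using that by (auto simp: I_def simp flip: of_int_add distrib_left simp del: of_int_mult)
    show "a * b \<in> I" if "a \<in> \<int>" "b \<in> I" for a b
      using that by (auto simp: I_def mult.left_commute elim!: Ints_cases
          simp flip: of_int_mult)
    show "1 \<notin> I"
    proof
      assume "1 \<in> I"
      then obtain j where "(of_int (m * j) :: 'a) = of_int 1"
        by (auto simp: I_def)
      then have "m * j = 1"
        by (simp only: of_int_eq_iff)
      then show False
        using m by (auto simp: zmult_eq_1_iff)
    qed
    show "\<exists>T. finite T \<and> (\<forall>a\<in>\<int>. \<exists>t\<in>T. a - t \<in> I)"
    proof (intro exI[of _ "of_int ` {0..<m}"] conjI ballI)
      fix a :: 'a assume "a \<in> \<int>"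
      then obtain j where j: "a = of_int j"
        by (auto elim: Ints_cases)
      have "a - of_int (j mod m) = of_int (m * (j div m))"
        unfolding j of_int_diff[symmetric] by (simp add: minus_mod_eq_mult_div)
      then show "\<exists>t\<in>of_int ` {0..<m}. a - t \<in> I"
        using m by (auto simp: I_def intro!: bexI[of _ "j mod m"])
    qed auto
  qed
  moreover have "1 - d * of_int (- sgn k) = of_int (m * 1)"
    by (simp add: k m_def abs_sgn)
  then have "1 - d * of_int (- sgn k) \<in> I"
    by (auto simp: I_def)
  ultimately show "\<exists>I. finite_index_ideal \<int> I \<and> (\<exists>u\<in>\<int>. 1 - d * u \<in> I)"
    by (meson Ints_of_int)
qed

text \<open>The induction works because \<open>residually_finite_units\<close> supplies units and
  not merely nonzero residues: division modulo \<open>I\<close> needs a leading coefficient that is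
  invertible there.\<close>

lemma residually_finite_units_adjoin:
  assumes "unital_subring A" and A: "residually_finite_units A"
  shows "residually_finite_units (adjoin A x)"
  unfolding residually_finite_units_def
proof (intro ballI impI)
  interpret unital_subring A by fact
  interpret B: unital_subring "adjoin A x"
    by (rule unital_subring_adjoin)
  have ev: "poly q x \<in> adjoin A x" if "q \<in> polys_over A" for q
    using that by (auto simp: adjoin_def)
  fix b assume b: "b \<in> adjoin A x" "b \<noteq> 0"
  show "\<exists>J. finite_index_ideal (adjoin A x) J \<and> (\<exists>v\<in>adjoin A x. 1 - b * v \<in> J)"
  proof (cases "\<exists>q\<in>polys_over A. q \<noteq> 0 \<and> poly q x = 0")
    case False
    obtain \<beta> where \<beta>: "\<beta> \<in> polys_over A" "b = poly \<beta> x"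
      using b by (auto simp: adjoin_def)
    have "\<beta> \<noteq> 0"
      using b \<beta> by auto
    then obtain I u where I: "finite_index_ideal A I" and u: "u \<in> A" "1 - lead_coeff \<beta> * u \<in> I"
      using A polys_overD[OF \<beta>(1)] leading_coeff_neq_0 unfolding residually_finite_units_def
      by metis
    interpret finite_index_ideal A I by fact
    \<comment> \<open>This is \<open>X * \<beta> + 1\<close>. Its value at \<open>x\<close> is
      \<open>1 + x * b\<close>, so \<open>- x\<close> inverts \<open>b\<close> modulo
      \<open>J\<close>. It keeps the leading coefficient of \<open>\<beta>\<close> and has positive
      degree even when \<open>\<beta>\<close> is constant.\<close>
    define g where "g = pCons 1 \<beta>"
    have g: "g \<in> polys_over A" "degree g > 0" "lead_coeff g = lead_coeff \<beta>"
      using \<beta>(1) \<open>\<beta> \<noteq> 0\<close> one_mem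
      by (auto simp: g_def polys_over_def coeff_pCons split: nat.split)
    let ?J = "{poly (g * h + i) x | h i. h \<in> polys_over A \<and> i \<in> polys_over I}"
    have "finite_index_ideal (adjoin A x) ?J"
    proof (rule finite_index_ideal_adjoin[OF g(1,2) _ u(1)])
      show "1 - lead_coeff g * u \<in> I"
        using u g by simp
      fix q assume "q \<in> polys_over A" "poly q x = 0"
      then show "\<exists>k. \<exists>h\<in>polys_over A. smult (lead_coeff g ^ k) q = g * h"
        using False polys_zero_mem by (intro exI[of _ 0] bexI[of _ 0]) auto
    qed
    moreover have "1 - b * (- x) = poly (g * 1 + 0) x"
      by (simp add: g_def \<beta>)
    then have "1 - b * (- x) \<in> ?J"
      using polys_one_mem polys_zero_ideal by blast
    ultimately show ?thesis
      using B.minus_mem[OF adjoin_generator] by blast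
  next
    case True
    define root where "root q \<longleftrightarrow> q \<in> polys_over A \<and> q \<noteq> 0 \<and> poly q x = 0" for q
    \<comment> \<open>A substitute for the minimal polynomial, not necessarily monic. By minimality,
      a pseudo-remainder modulo \<open>g\<close> that vanishes at \<open>x\<close> is zero.\<close>
    obtain g where "root g" and min: "\<And>q. root q \<Longrightarrow> degree g \<le> degree q"
      using True ex_has_least_nat[of root _ degree] by (auto simp: root_def)
    then have g: "g \<in> polys_over A" "g \<noteq> 0" "poly g x = 0"
      by (auto simp: root_def)
    have min: "q = 0" if "q \<in> polys_over A" "poly q x = 0" "degree q < degree g" for q
      using min[of q] that by (force simp: root_def)
    have deg: "degree g > 0"
      using g by (auto intro!: gr0I elim!: degree_eq_zeroE)
    \<comment> \<open>The principal ideal of \<open>b\<close> meets \<open>A\<close>: a multiple of \<open>b\<close> that has minimal degree in \<open>x\<close>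
      is constant, as otherwise it would yield a factor of \<open>g\<close>.\<close>
    define mult where "mult s \<longleftrightarrow> s \<in> polys_over A \<and> poly s x \<noteq> 0 \<and>
      (\<exists>v\<in>adjoin A x. poly s x = b * v)" for s
    have "\<exists>s. mult s"
    proof -
      obtain \<beta> where "\<beta> \<in> polys_over A" "b = poly \<beta> x"
        using b by (auto simp: adjoin_def)
      then show ?thesis
        using b B.one_mem unfolding mult_def by (metis mult.right_neutral)
    qed
    then obtain s where "mult s" and smin: "\<And>q. mult q \<Longrightarrow> degree s \<le> degree q"
      using ex_has_least_nat[of mult _ degree] by auto
    then obtain v where s: "s \<in> polys_over A" "poly s x \<noteq> 0" and v: "v \<in> adjoin A x"
      "poly s x = b * v"
      by (auto simp: mult_def)
    \<comment> \<open>As \<open>g\<close> vanishes at \<open>x\<close>, the pseudo-remainder of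
      \<open>s\<close> by \<open>g\<close> has the value \<open>lead_coeff g ^ k * poly s x\<close>
      there. So it satisfies \<open>mult\<close> too, and \<open>s\<close> has no larger
      degree.\<close>
    have sdeg: "degree s < degree g"
    proof -
      obtain k h t where t: "h \<in> polys_over A" "t \<in> polys_over A"
        "smult (lead_coeff g ^ k) s = g * h + t" "degree t < degree g"
        using pseudo_division[OF g(1) deg s(1)] by blast
      have "poly t x = lead_coeff g ^ k * poly s x"
        using arg_cong[OF t(3), of "\<lambda>p. poly p x"] g(3) by simp
      then have "poly t x = b * (lead_coeff g ^ k * v)" "poly t x \<noteq> 0"
        using v s g by auto
      moreover have "lead_coeff g ^ k * v \<in> adjoin A x"
        using v subset_adjoin power_mem[OF polys_overD[OF g(1)]] by (auto intro!: B.mult_mem)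
      ultimately have "mult t"
        using t(2) unfolding mult_def by blast
      then show ?thesis
        using smin t(4) by fastforce
    qed
    have "degree s = 0"
    proof (rule ccontr)
      assume "degree s \<noteq> 0"
      then have "degree s > 0"
        by simp
      then obtain k h t where t: "h \<in> polys_over A" "t \<in> polys_over A"
        "smult (lead_coeff s ^ k) g = s * h + t" "degree t < degree s"
        using pseudo_division[OF s(1) _ g(1)] by blast
      have "poly t x = b * (- v * poly h x)"
        using arg_cong[OF t(3), of "\<lambda>p. poly p x"] g(3) v(2)
        by (simp add: algebra_simps add_eq_0_iff)
      moreover have "- v * poly h x \<in> adjoin A x"
        using v ev t(1) by (intro B.mult_mem B.minus_mem)
      \<comment> \<open>Otherwise \<open>t\<close> would satisfy \<open>mult\<close> with a degree
        below that of \<open>s\<close>.\<close>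
      ultimately have "poly t x = 0"
        using t(2,4) smin[of t] unfolding mult_def by fastforce
      then have "t = 0"
        using min t(2,4) sdeg by simp
      then have sh: "smult (lead_coeff s ^ k) g = s * h"
        using t(3) by simp
      have "s \<noteq> 0"
        using s by auto
      then have "s * h \<noteq> 0"
        using g(2) by (simp flip: sh)
      then have "h \<noteq> 0" "degree g = degree s + degree h"
        using arg_cong[OF sh, of degree] \<open>s \<noteq> 0\<close> by (auto simp: degree_mult_eq)
      moreover have "poly h x = 0"
        using arg_cong[OF sh, of "\<lambda>p. poly p x"] g(3) s(2) by simp
      ultimately show False
        using min[OF t(1)] \<open>degree s > 0\<close> by simp
    qed
    then obtain e where e: "s = [:e:]"
      by (auto elim: degree_eq_zeroE)
    then have e: "e \<in> A" "e \<noteq> 0" "e = b * v"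
      using s v polys_overD[OF s(1), of 0] by auto
    define l where "l = lead_coeff g"
    have l: "l \<in> A" "l \<noteq> 0"
      using g polys_overD[OF g(1)] by (auto simp: l_def)
    \<comment> \<open>One ideal serves both purposes: modulo \<open>I\<close>, \<open>e * u\<close>
      inverts \<open>l\<close> and \<open>l * u\<close> inverts \<open>e\<close>. As
      \<open>e = b * v\<close>, the inverse of \<open>b\<close> modulo \<open>J\<close> is
      \<open>v * (l * u)\<close>.\<close>
    obtain I u where I: "finite_index_ideal A I" and u: "u \<in> A" "1 - (l * e) * u \<in> I"
      using A mult_mem[OF l(1) e(1)] l(2) e(2) unfolding residually_finite_units_def
      by (metis mult_eq_0_iff)
    interpret finite_index_ideal A I by fact
    let ?J = "{poly (g * h + i) x | h i. h \<in> polys_over A \<and> i \<in> polys_over I}"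
    have "finite_index_ideal (adjoin A x) ?J"
    proof (rule finite_index_ideal_adjoin[OF g(1) deg, where u = "e * u"])
      show "1 - lead_coeff g * (e * u) \<in> I" "e * u \<in> A"
        using u e(1) by (auto simp: l_def mult.assoc intro: mult_mem)
      fix q assume q: "q \<in> polys_over A" "poly q x = 0"
      then obtain k h t where t: "h \<in> polys_over A" "t \<in> polys_over A"
        "smult (lead_coeff g ^ k) q = g * h + t" "degree t < degree g"
        using pseudo_division[OF g(1) deg] by blast
      have "poly t x = 0"
        using arg_cong[OF t(3), of "\<lambda>p. poly p x"] g(3) q(2) by simp
      then have "t = 0"
        using min t by blast
      then show "\<exists>k. \<exists>h\<in>polys_over A. smult (lead_coeff g ^ k) q = g * h"
        using t by auto
    qed
    moreover have "1 - b * (v * (l * u)) = poly (g * 0 + [:1 - (l * e) * u:]) x"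
      by (simp add: e(3) algebra_simps)
    moreover have "[:1 - (l * e) * u:] \<in> polys_over I"
      using u zero_ideal by (auto simp: polys_over_def coeff_pCons split: nat.split)
    ultimately have "1 - b * (v * (l * u)) \<in> ?J"
      using polys_zero_mem by blast
    moreover have "v * (l * u) \<in> adjoin A x"
      using v l u subset_adjoin by (blast intro: B.mult_mem)
    ultimately show ?thesis
      using \<open>finite_index_ideal (adjoin A x) ?J\<close> by blast
  qed
qed

text \<open>Start from the integers and adjoin the elements of \<open>S\<close> one at a
  time.\<close>

lemma finite_subset_residually_finite_units:
  fixes S :: "'a::{idom, ring_char_0} set"
  assumes "finite S"
  shows "\<exists>A. unital_subring A \<and> S \<subseteq> A \<and> residually_finite_units A"
  using assms
proof (induction S)
  case empty
  then show ?case
    using unital_subring_Ints residually_finite_units_Ints by blast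
next
  case (insert x S)
  then obtain A where A: "unital_subring A" "S \<subseteq> A" "residually_finite_units A"
    by blast
  then have "unital_subring (adjoin A x)" "insert x S \<subseteq> adjoin A x"
    using unital_subring.unital_subring_adjoin unital_subring.subset_adjoin
      unital_subring.adjoin_generator by fastforce+
  then show ?case
    using residually_finite_units_adjoin[OF A(1,3)] by blast
qed

section \<open>Exponential sums modulo an ideal of finite index\<close>

lemma power_int_mem:
  fixes z :: "'a::field"
  assumes "unital_subring A" "z \<in> A" "inverse z \<in> A"
  shows "z powi k \<in> A"
  using assms by (auto simp: power_int_def intro: unital_subring.power_mem)

context finite_index_ideal
begin

text \<open>By pigeonhole two powers of \<open>z\<close> agree modulo \<open>I\<close>; multiplying
  by a power of \<open>w\<close> cancels the smaller one.\<close>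

lemma power_cong_one_of_unit:
  assumes z: "z \<in> A" and w: "w \<in> A" and zw: "z * w = 1"
  shows "\<exists>N>0. 1 - z ^ N \<in> I"
proof -
  obtain T where T: "finite T" "\<And>a. a \<in> A \<Longrightarrow> \<exists>t\<in>T. a - t \<in> I"
    using finite_index by blast
  obtain t where t: "\<And>n::nat. t n \<in> T \<and> z ^ n - t n \<in> I"
    using T(2)[OF power_mem[OF z]] by metis
  have "\<not> inj t"
    using T(1) t by (metis finite_subset image_subsetI infinite_UNIV_nat finite_imageD)
  then obtain a b where ab: "t a = t b" "a < b"
    by (metis injI linorder_neqE_nat)
  have "w ^ a * ((z ^ a - t a) - (z ^ b - t b)) \<in> I"
    using t by (intro mult_ideal[OF power_mem[OF w]] diff_ideal[of "_ - _" "_ - _"]) auto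
  moreover have "z ^ b = z ^ a * z ^ (b - a)"
    using ab by (simp flip: power_add)
  then have "w ^ a * (z ^ a - z ^ b) = (z * w) ^ a * (1 - z ^ (b - a))"
    by (simp add: power_mult_distrib algebra_simps)
  ultimately have "1 - z ^ (b - a) \<in> I"
    using ab(1) zw by simp
  then show ?thesis
    using ab(2) by (intro exI[of _ "b - a"]) auto
qed

lemma prod_cong_one:
  assumes "\<And>j. j \<in> S \<Longrightarrow> a j \<in> A" "\<And>j. j \<in> S \<Longrightarrow> 1 - a j \<in> I"
  shows "1 - prod a S \<in> I"
  using assms
proof (induction S rule: infinite_finite_induct)
  case (insert x S)
  then have "1 * 1 - a x * prod a S \<in> I"
    by (intro mult_cong one_mem) auto
  then show ?case
    using insert by simp
qed (auto simp: zero_ideal)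

end

text \<open>The product of periods of the single elements is a common period. Negative
  \<open>k\<close> is handled through powers of \<open>inverse z\<close>.\<close>

lemma power_int_cong_one_of_units:
  fixes Z :: "'a::field set"
  assumes I: "finite_index_ideal A I" and "finite Z"
    and Z: "\<And>z. z \<in> Z \<Longrightarrow> z \<noteq> 0 \<and> z \<in> A \<and> inverse z \<in> A"
  shows "\<exists>N>0. \<forall>z\<in>Z. \<forall>k. 1 - z powi (int N * k) \<in> I"
  using assms(2) Z
proof (induction Z)
  case (insert z Z)
  interpret finite_index_ideal A I by fact
  obtain N where N: "N > 0" "\<And>y k. y \<in> Z \<Longrightarrow> 1 - y powi (int N * k) \<in> I"
    using insert by blast
  have z: "z \<noteq> 0" "z \<in> A" "inverse z \<in> A"
    using insert.prems by auto
  obtain M where M: "M > 0" "1 - z ^ M \<in> I"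
    using power_cong_one_of_unit[OF z(2,3)] z(1) by auto
  have "inverse z ^ M * (z ^ M - 1) \<in> I"
    using minus_ideal[OF M(2)] z by (intro mult_ideal power_mem) auto
  moreover have "inverse z ^ M * (z ^ M - 1) = 1 - inverse z ^ M"
    using z(1) by (simp add: right_diff_distrib flip: power_mult_distrib)
  ultimately have M': "1 - inverse z ^ M \<in> I"
    by simp
  have zk: "1 - z powi (int M * k) \<in> I" for k
  proof (cases "k \<ge> 0")
    case True
    then have "z powi (int M * k) = (z ^ M) ^ nat k"
      by (simp add: power_int_mult power_int_def[of _ k])
    then show ?thesis
      using power_cong_one[OF M(2)] z by (simp add: power_mem)
  next
    case False
    then have "z powi (int M * k) = (inverse z ^ M) ^ nat (- k)"
      by (simp add: power_int_mult power_int_def[of _ k] power_inverse)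
    then show ?thesis
      using power_cong_one[OF M'] z by (simp add: power_mem)
  qed
  have "1 - y powi (int (M * N) * k) \<in> I" if "y \<in> insert z Z" for y k
    using that zk[of "int N * k"] N(2)[of y "int M * k"] by (auto simp: mult_ac)
  then show ?case
    using M(1) N(1) by (intro exI[of _ "M * N"]) auto
qed (auto intro: exI[of _ 1])

text \<open>Reduced modulo a suitable ideal of finite index in a ring containing all coefficients and
  bases, the sum becomes periodic, and its value at \<open>m\<close> stays nonzero.\<close>

lemma exponential_sum_nonzero_on_coset:
  fixes c :: "'i \<Rightarrow> 'a::field_char_0" and z :: "'i \<Rightarrow> 'j \<Rightarrow> 'a"
  assumes fin: "finite S" "finite R"
    and z: "\<And>i j. i \<in> S \<Longrightarrow> j \<in> R \<Longrightarrow> z i j \<noteq> 0"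
    and nz: "(\<Sum>i\<in>S. c i * (\<Prod>j\<in>R. z i j powi m j)) \<noteq> 0"
  shows "\<exists>N>0. \<forall>k. (\<Sum>i\<in>S. c i * (\<Prod>j\<in>R. z i j powi (m j + int N * k j))) \<noteq> 0"
proof -
  define Z where "Z = (\<lambda>(i, j). z i j) ` (S \<times> R)"
  have "finite (c ` S \<union> Z \<union> inverse ` Z)"
    using fin by (simp add: Z_def)
  then obtain A where A: "unital_subring A" "c ` S \<union> Z \<union> inverse ` Z \<subseteq> A"
    "residually_finite_units A"
    using finite_subset_residually_finite_units by metis
  interpret unital_subring A by fact
  have mem: "c i \<in> A" if "i \<in> S" for i
    using A(2) that by auto
  have zmem: "z i j powi k \<in> A" if "i \<in> S" "j \<in> R" for i j k
  proof -
    have "z i j \<in> Z"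
      using that by (auto simp: Z_def)
    then show ?thesis
      using A by (intro power_int_mem) auto
  qed
  have "(\<Sum>i\<in>S. c i * (\<Prod>j\<in>R. z i j powi m j)) \<in> A" (is "?d \<in> A")
    by (intro sum_mem mult_mem mem prod_mem zmem)
  then obtain I u where I: "finite_index_ideal A I" "u \<in> A" "1 - ?d * u \<in> I"
    using A(3) nz unfolding residually_finite_units_def by blast
  interpret finite_index_ideal A I by fact
  have dI: "?d \<notin> I"
    using unit_not_ideal[OF I(3,2)] .
  have "\<exists>N>0. \<forall>y\<in>Z. \<forall>k. 1 - y powi (int N * k) \<in> I"
  proof (rule power_int_cong_one_of_units[OF I(1)])
    show "finite Z"
      using fin by (simp add: Z_def)
    show "y \<noteq> 0 \<and> y \<in> A \<and> inverse y \<in> A" if "y \<in> Z" for y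
    proof -
      have "y \<in> A \<and> inverse y \<in> A"
        using that A(2) by auto
      then show ?thesis
        using that z by (auto simp: Z_def)
    qed
  qed
  then obtain N where N: "N > 0" "\<And>y k. y \<in> Z \<Longrightarrow> 1 - y powi (int N * k) \<in> I"
    by blast
  have "(\<Sum>i\<in>S. c i * (\<Prod>j\<in>R. z i j powi (m j + int N * k j))) \<noteq> 0" (is "?e \<noteq> 0") for k
  proof
    assume e: "?e = 0"
    have "?d - ?e = (\<Sum>i\<in>S. c i * (\<Prod>j\<in>R. z i j powi m j) *
        (1 - (\<Prod>j\<in>R. z i j powi (int N * k j))))"
      unfolding sum_subtractf[symmetric]
      by (intro sum.cong) (auto simp: z power_int_add prod.distrib algebra_simps)
    also have "\<dots> \<in> I"
      using N(2) by (intro sum_ideal mult_ideal mult_mem mem prod_mem prod_cong_one zmem)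
        (auto simp: Z_def)
    finally show False
      using e dI by simp
  qed
  then show ?thesis
    using N(1) by blast
qed

section \<open>The dual group\<close>

lemma characters_norm: "\<chi> \<in> characters \<Longrightarrow> norm (\<chi> x) = 1"
  and characters_add: "\<chi> \<in> characters \<Longrightarrow> \<chi> (x + y) = \<chi> x * \<chi> y"
  by (auto simp: characters_def)

lemma characters_nonzero: "\<chi> \<in> characters \<Longrightarrow> \<chi> x \<noteq> 0"
  using characters_norm[of \<chi> x] by auto

lemma characters_one: "(\<lambda>_. 1) \<in> characters"
  by (simp add: characters_def)

lemma characters_mult:
  "\<chi> \<in> characters \<Longrightarrow> \<psi> \<in> characters \<Longrightarrow> (\<lambda>x. \<chi> x * \<psi> x) \<in> characters"
  by (simp add: characters_def norm_mult)

lemma characters_inverse: "\<chi> \<in> characters \<Longrightarrow> (\<lambda>x. inverse (\<chi> x)) \<in> characters"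
  by (simp add: characters_def norm_inverse)

text \<open>Translating by \<open>x\<close> permutes the factors of the product of all values of
  \<open>\<chi>\<close> and multiplies it by \<open>\<chi> x ^ card UNIV\<close>. Hence all values
  lie in one finite set of roots of unity.\<close>

lemma finite_characters: "finite (characters :: ('f::{ab_group_add, finite} \<Rightarrow> complex) set)"
proof -
  have "\<chi> x ^ card (UNIV :: 'f set) = 1" if \<chi>: "\<chi> \<in> characters" for \<chi> :: "'f \<Rightarrow> complex" and x
  proof -
    have "(\<Prod>y\<in>UNIV. \<chi> y) = (\<Prod>y\<in>UNIV. \<chi> (x + y))"
      using prod.reindex_bij_betw[OF bij_plus[of x], of \<chi>] by simp
    also have "\<dots> = \<chi> x ^ card (UNIV :: 'f set) * (\<Prod>y\<in>UNIV. \<chi> y)"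
      by (simp add: characters_add[OF \<chi>] prod.distrib)
    finally show ?thesis
      using characters_nonzero[OF \<chi>] by simp
  qed
  \<comment> \<open>The trivial conditions on \<open>UNIV\<close> give the set the shape required by
    \<open>finite_set_of_finite_funs\<close>.\<close>
  then have "characters \<subseteq> {\<chi> :: 'f \<Rightarrow> complex. \<forall>x. (x \<in> UNIV \<longrightarrow> \<chi> x \<in> {w. w ^ card (UNIV :: 'f set) = 1}) \<and>
      (x \<notin> UNIV \<longrightarrow> \<chi> x = 0)}"
    by auto
  moreover have "finite \<dots>"
    by (intro finite_set_of_finite_funs finite_roots_unity) (simp_all add: Suc_le_eq card_gt_0_iff)
  ultimately show ?thesis
    by (rule finite_subset)
qed

text \<open>Translating the summation variable by \<open>x\<close> multiplies the sum by
  \<open>\<chi> x\<close>.\<close>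

lemma sum_character_eq_0:
  fixes \<chi> :: "'f::{ab_group_add, finite} \<Rightarrow> complex"
  assumes "\<chi> \<in> characters" "\<chi> x \<noteq> 1"
  shows "(\<Sum>y\<in>UNIV. \<chi> y) = 0"
proof -
  have "(\<Sum>y\<in>UNIV. \<chi> y) = (\<Sum>y\<in>UNIV. \<chi> (x + y))"
    using sum.reindex_bij_betw[OF bij_plus[of x], of \<chi>] by simp
  also have "\<dots> = \<chi> x * (\<Sum>y\<in>UNIV. \<chi> y)"
    by (simp add: characters_add[OF assms(1)] sum_distrib_left)
  finally show ?thesis
    using assms(2) by simp
qed

section \<open>The dual group and its subgroups of finite index\<close>

lemma carrier_dual_group [simp]: "carrier (dual_group r) = dual_carrier r"
  and one_dual_group [simp]: "\<one>\<^bsub>dual_group r\<^esub> = ((\<lambda>_. 1), (\<lambda>_. 0))"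
  and mult_dual_group [simp]:
    "a \<otimes>\<^bsub>dual_group r\<^esub> b = ((\<lambda>x. fst a x * fst b x), (\<lambda>i. snd a i + snd b i))"
  by (simp_all add: dual_group_def)

lemma mem_dual_carrier [simp]:
  "(\<chi>, m) \<in> dual_carrier r \<longleftrightarrow> \<chi> \<in> characters \<and> (\<forall>i\<ge>r. m i = 0)"
  by (simp add: dual_carrier_def)

lemma comm_group_dual_group: "comm_group (dual_group r)"
proof (rule comm_groupI)
  fix a assume "a \<in> carrier (dual_group r)"
  moreover obtain \<chi> m where a: "a = (\<chi>, m)"
    by (cases a)
  ultimately have "\<chi> \<in> characters" "\<forall>i\<ge>r. m i = 0"
    by auto
  then show "\<exists>b\<in>carrier (dual_group r). b \<otimes>\<^bsub>dual_group r\<^esub> a = \<one>\<^bsub>dual_group r\<^esub>"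
    unfolding a
    by (intro bexI[of _ "((\<lambda>x. inverse (\<chi> x)), (\<lambda>i. - m i))"])
      (auto simp: characters_inverse characters_nonzero)
qed (auto simp: dual_carrier_def characters_one characters_mult mult_ac add_ac)

lemma inv_dual_group:
  assumes "(\<chi>, m) \<in> dual_carrier r"
  shows "inv\<^bsub>dual_group r\<^esub> (\<chi>, m) = ((\<lambda>x. inverse (\<chi> x)), (\<lambda>i. - m i))"
  using assms
  by (intro group.inv_equality comm_group.axioms(2)[OF comm_group_dual_group])
    (auto simp: characters_inverse characters_nonzero)

text \<open>For \<open>N > 0\<close> these have finite index, and every subgroup of finite index
  contains one of them. So ubiquity amounts to meeting all their cosets.\<close>

definition congruence_subgroup :: "nat \<Rightarrow> nat \<Rightarrow> (('f::ab_group_add \<Rightarrow> complex) \<times> (nat \<Rightarrow> int)) set" where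
  "congruence_subgroup r N = {\<lambda>_. 1} \<times> {m. (\<forall>i\<ge>r. m i = 0) \<and> (\<forall>i. int N dvd m i)}"

lemma subgroup_congruence_subgroup: "subgroup (congruence_subgroup r N) (dual_group r)"
proof -
  interpret comm_group "dual_group r"
    by (rule comm_group_dual_group)
  show ?thesis
    by (rule subgroupI)
      (auto simp: congruence_subgroup_def characters_one inv_dual_group intro: exI[of _ "\<lambda>_. 0"])
qed

text \<open>Each coset has a representative with exponents reduced modulo \<open>N\<close>, and
  there are finitely many characters.\<close>

lemma finite_rcosets_congruence_subgroup:
  assumes "N > 0"
  shows "finite (rcosets\<^bsub>dual_group r\<^esub>
    (congruence_subgroup r N :: (('f::{ab_group_add, finite} \<Rightarrow> complex) \<times> (nat \<Rightarrow> int)) set))"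
proof -
  let ?G = "dual_group r :: (('f \<Rightarrow> complex) \<times> (nat \<Rightarrow> int)) monoid"
  let ?H = "congruence_subgroup r N :: (('f \<Rightarrow> complex) \<times> (nat \<Rightarrow> int)) set"
  interpret comm_group ?G
    by (rule comm_group_dual_group)
  let ?M = "{m. \<forall>i. (i \<in> {..<r} \<longrightarrow> m i \<in> {0..<int N}) \<and> (i \<notin> {..<r} \<longrightarrow> m i = 0)}"
  have "rcosets\<^bsub>?G\<^esub> ?H \<subseteq> (\<lambda>a. ?H #>\<^bsub>?G\<^esub> a) ` (characters \<times> ?M)"
  proof
    fix C assume "C \<in> rcosets\<^bsub>?G\<^esub> ?H"
    then obtain \<chi> m where \<chi>: "\<chi> \<in> characters" and m: "\<forall>i\<ge>r. m i = 0" and C: "C = ?H #>\<^bsub>?G\<^esub> (\<chi>, m)"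
      by (auto simp: RCOSETS_def)
    define m' where "m' i = m i mod int N" for i
    have "((\<lambda>_. 1), (\<lambda>i. m' i - m i)) \<in> ?H"
      using m by (auto simp: congruence_subgroup_def m'_def mod_eq_dvd_iff[symmetric])
    then have "(\<chi>, m') \<in> ?H #>\<^bsub>?G\<^esub> (\<chi>, m)"
      by (force simp: r_coset_def)
    then have "C = ?H #>\<^bsub>?G\<^esub> (\<chi>, m')"
      unfolding C using \<chi> m by (intro repr_independence subgroup_congruence_subgroup) auto
    moreover have "m' \<in> ?M"
      using m assms by (auto simp: m'_def)
    ultimately show "C \<in> (\<lambda>a. ?H #>\<^bsub>?G\<^esub> a) ` (characters \<times> ?M)"
      using \<chi> by blast
  qed
  moreover have "finite ?M"
    by (rule finite_set_of_finite_funs) auto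
  ultimately show ?thesis
    using finite_characters by (meson finite_SigmaI finite_imageI finite_subset)
qed

text \<open>Lagrange in the quotient group: its order serves as \<open>N\<close>.\<close>

lemma (in comm_group) finite_index_pow_mem:
  assumes H: "subgroup H G" and fin: "finite (rcosets H)"
  shows "\<exists>N>0. \<forall>g\<in>carrier G. g [^] (N::nat) \<in> H"
proof -
  interpret normal H G
    using H by (rule subgroup_imp_normal)
  interpret Q: group "G Mod H"
    by (rule factorgroup_is_group)
  have fin: "finite (carrier (G Mod H))"
    using fin by (simp add: FactGroup_def)
  have "g [^] Coset.order (G Mod H) \<in> H" if g: "g \<in> carrier G" for g
  proof -
    have hom: "(\<lambda>a. H #> a) \<in> hom G (G Mod H)"
      by (rule r_coset_hom_Mod)
    have "H #> (g [^] Coset.order (G Mod H)) = (H #> g) [^]\<^bsub>G Mod H\<^esub> Coset.order (G Mod H)"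
      using hom_nat_pow[OF hom g group_axioms Q.group_axioms] by simp
    also have "\<dots> = \<one>\<^bsub>G Mod H\<^esub>"
      using hom g by (intro Q.pow_order_eq_1) (auto simp: hom_def)
    finally have "H #> (g [^] Coset.order (G Mod H)) = H"
      by (simp add: FactGroup_def)
    then show ?thesis
      using rcos_self[OF nat_pow_closed[OF g] H] by metis
  qed
  moreover have "Coset.order (G Mod H) > 0"
    using fin Q.order_gt_0_iff_finite by simp
  ultimately show ?thesis
    by blast
qed

lemma dual_group_nat_pow:
  "((\<lambda>_. 1), m) [^]\<^bsub>dual_group r\<^esub> (n::nat) = ((\<lambda>_. 1), (\<lambda>i. int n * m i))"
  by (induction n) (auto simp: nat_pow_def dual_group_def algebra_simps)

text \<open>With \<open>N\<close> such that all \<open>N\<close>-th powers lie in \<open>H\<close>,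
  every element of the congruence subgroup is an \<open>N\<close>-th power: divide its exponents by
  \<open>N\<close>.\<close>

lemma congruence_subgroup_subset:
  assumes "subgroup H (dual_group r)" "finite (rcosets\<^bsub>dual_group r\<^esub> H)"
  shows "\<exists>N>0. congruence_subgroup r N \<subseteq> H"
proof -
  obtain N where N: "N > 0" "\<And>g. g \<in> dual_carrier r \<Longrightarrow> g [^]\<^bsub>dual_group r\<^esub> (N::nat) \<in> H"
    using comm_group.finite_index_pow_mem[OF comm_group_dual_group assms] by auto
  have "((\<lambda>_. 1), m) \<in> H" if m: "\<forall>i\<ge>r. m i = 0" "\<forall>i. int N dvd m i" for m
  proof -
    have "((\<lambda>_. 1), (\<lambda>i. m i div int N)) \<in> dual_carrier r"
      using m by (simp add: characters_one)
    from N(2)[OF this] show ?thesis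
      using m by (simp add: dual_group_nat_pow)
  qed
  then show ?thesis
    using N(1) by (auto simp: congruence_subgroup_def)
qed

section \<open>From ubiquity to strict positive definiteness\<close>

lemma ubiquitous_imp_strictly_pd:
  fixes K :: "(('f::{ab_group_add, finite} \<Rightarrow> complex) \<times> (nat \<Rightarrow> int)) set"
  assumes "ubiquitous r K"
  shows "strictly_pd r K"
  unfolding strictly_pd_def
proof (intro allI impI ballI)
  fix n :: nat and x :: "nat \<Rightarrow> 'f \<times> (nat \<Rightarrow> complex)" and c
    and \<gamma> :: "('f \<Rightarrow> complex) \<times> (nat \<Rightarrow> int)"
  assume *: "(\<forall>i<n. x i \<in> G_pts r) \<and> (\<forall>\<gamma>\<in>K. trig_poly r n x c \<gamma> = 0)" and \<gamma>: "\<gamma> \<in> dual_carrier r"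
  obtain \<chi> m where \<gamma>_eq: "\<gamma> = (\<chi>, m)"
    by (cases \<gamma>)
  show "trig_poly r n x c \<gamma> = 0"
  proof (rule ccontr)
    \<comment> \<open>Congruence subgroups are trivial in the \<open>F\<close>-component, so on the
      coset of \<open>\<gamma>\<close> the character \<open>\<chi>\<close> is fixed and can be
      absorbed into the coefficients.\<close>
    define c' where "c' i = c i * \<chi> (fst (x i))" for i
    have tp: "trig_poly r n x c (\<chi>, k) = (\<Sum>i<n. c' i * (\<Prod>j<r. snd (x i) j powi k j))" for k
      by (simp add: trig_poly_def char_eval_def c'_def mult.assoc)
    assume "trig_poly r n x c \<gamma> \<noteq> 0"
    then have "(\<Sum>i<n. c' i * (\<Prod>j<r. snd (x i) j powi m j)) \<noteq> 0"
      by (simp add: \<gamma>_eq tp)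
    moreover have "snd (x i) j \<noteq> 0" if "i < n" "j < r" for i j
      using * that by (force simp: G_pts_def torus_pts_def)
    ultimately obtain N where N: "N > 0"
      "\<And>k. (\<Sum>i<n. c' i * (\<Prod>j<r. snd (x i) j powi (m j + int N * k j))) \<noteq> 0"
      using exponential_sum_nonzero_on_coset[of "{..<n}" "{..<r}" "\<lambda>i. snd (x i)" c' m] by auto
    have "(\<gamma> <#\<^bsub>dual_group r\<^esub> congruence_subgroup r N) \<inter> K \<noteq> {}"
      by (rule assms[unfolded ubiquitous_def, rule_format])
        (intro conjI subgroup_congruence_subgroup finite_rcosets_congruence_subgroup N(1) \<gamma>)
    then obtain h where h: "\<forall>i. int N dvd h i" and K: "(\<chi>, \<lambda>i. m i + h i) \<in> K"
      by (auto simp: l_coset_def congruence_subgroup_def \<gamma>_eq)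
    have "h i = int N * (h i div int N)" for i
      using h by simp
    then have "trig_poly r n x c (\<chi>, \<lambda>i. m i + h i) \<noteq> 0"
      using N(2)[of "\<lambda>i. h i div int N"] unfolding tp by simp
    then show False
      using * K by blast
  qed
qed

section \<open>Orthogonality, and from strict positive definiteness to ubiquity\<close>

lemma strictly_pdD:
  assumes "strictly_pd r K" and "finite S" and pts: "\<And>s. s \<in> S \<Longrightarrow> x s \<in> G_pts r"
    and zero: "\<And>\<gamma>. \<gamma> \<in> K \<Longrightarrow> (\<Sum>s\<in>S. c s * char_eval r \<gamma> (x s)) = 0"
    and \<gamma>: "\<gamma> \<in> dual_carrier r"
  shows "(\<Sum>s\<in>S. c s * char_eval r \<gamma> (x s)) = 0"
proof -
  \<comment> \<open>\<open>strictly_pd\<close> sums over initial segments of the naturals;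
    enumerating \<open>S\<close> permits other finite index sets, later pairs of a point of
    \<open>F\<close> and an exponent vector.\<close>
  obtain e where e: "bij_betw e {..<card S} S"
    using ex_bij_betw_nat_finite[OF assms(2)] by (auto simp: atLeast0LessThan)
  have eq: "trig_poly r (card S) (x \<circ> e) (c \<circ> e) \<delta> = (\<Sum>s\<in>S. c s * char_eval r \<delta> (x s))" for \<delta>
    using sum.reindex_bij_betw[OF e, of "\<lambda>s. c s * char_eval r \<delta> (x s)"] by (simp add: trig_poly_def)
  have "\<forall>i<card S. (x \<circ> e) i \<in> G_pts r"
    using e pts by (auto simp: bij_betw_def)
  moreover have "\<forall>\<delta>\<in>K. trig_poly r (card S) (x \<circ> e) (c \<circ> e) \<delta> = 0"
    by (simp add: eq zero)
  ultimately have "trig_poly r (card S) (x \<circ> e) (c \<circ> e) \<gamma> = 0"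
    using assms(1) \<gamma> unfolding strictly_pd_def by blast
  then show ?thesis
    by (simp add: eq)
qed

text \<open>The root of unity is primitive: a cosine equal to 1 forces the angle to be a multiple of
  \<open>2 * pi\<close>.\<close>

lemma cis_powi_eq_1D:
  assumes "N > 0" "cis (2 * pi / real N) powi d = 1"
  shows "int N dvd d"
proof -
  have "cos (real_of_int d * (2 * pi / real N)) = 1"
    using assms(2) by (simp add: cis_power_int complex_eq_iff)
  then obtain k :: int where "real_of_int d * (2 * pi / real N) = real_of_int k * 2 * pi"
    by (subst (asm) cos_one_2pi_int) blast
  then have "real_of_int d = real_of_int (k * int N)"
    using assms(1) by (simp add: field_simps)
  then have "d = k * int N"
    by (simp only: of_int_eq_iff)
  then show ?thesis
    by simp
qed

lemma sum_powers_root_of_unity_eq_0: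
  fixes y :: "'a::field"
  assumes "y ^ N = 1" "y \<noteq> 1"
  shows "(\<Sum>w<N. y ^ w) = 0"
  using assms by (simp add: sum_gp_strict)

text \<open>The test polynomial sums \<open>\<delta> / \<gamma>\<close> over the finite subgroup of
  \<open>G\<close> formed by \<open>F\<close> and the \<open>N\<close>-th roots of unity in each
  coordinate. This sum vanishes unless \<open>\<delta> / \<gamma>\<close> is trivial there, which
  means that it lies in \<open>congruence_subgroup r N\<close>. As the sum is nonzero at
  \<open>\<gamma>\<close>, it is nonzero somewhere on \<open>K\<close>.\<close>

lemma strictly_pd_imp_ubiquitous:
  fixes K :: "(('f::{ab_group_add, finite} \<Rightarrow> complex) \<times> (nat \<Rightarrow> int)) set"
  assumes K: "K \<subseteq> dual_carrier r" and spd: "strictly_pd r K"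
  shows "ubiquitous r K"
  unfolding ubiquitous_def
proof (intro allI impI)
  fix H :: "(('f \<Rightarrow> complex) \<times> (nat \<Rightarrow> int)) set"
    and \<gamma> :: "('f \<Rightarrow> complex) \<times> (nat \<Rightarrow> int)"
  assume "subgroup H (dual_group r) \<and> finite (rcosets\<^bsub>dual_group r\<^esub> H) \<and> \<gamma> \<in> dual_carrier r"
  then obtain N where N: "N > 0" "congruence_subgroup r N \<subseteq> H" and \<gamma>: "\<gamma> \<in> dual_carrier r"
    using congruence_subgroup_subset by blast
  obtain \<chi>\<^sub>0 m\<^sub>0 where \<gamma>_eq: "\<gamma> = (\<chi>\<^sub>0, m\<^sub>0)"
    by (cases \<gamma>)
  then have \<chi>\<^sub>0: "\<chi>\<^sub>0 \<in> characters" and m\<^sub>0: "\<forall>i\<ge>r. m\<^sub>0 i = 0"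
    using \<gamma> by auto
  define \<zeta> where "\<zeta> = cis (2 * pi / real N)"
  have \<zeta>: "\<zeta> \<noteq> 0" "\<zeta> ^ N = 1" "norm \<zeta> = 1"
    using N(1) by (auto simp: \<zeta>_def DeMoivre)
  define S where "S = (UNIV :: 'f set) \<times> ({..<r} \<rightarrow>\<^sub>E {..<N})"
  \<comment> \<open>Parametrizes that finite subgroup by \<open>F\<close> and exponent vectors;
    coordinates from \<open>r\<close> on are 1, as \<open>torus_pts\<close> demands.\<close>
  define x where "x = (\<lambda>(f::'f, w). (f, \<lambda>j. if j < r then \<zeta> ^ w j else 1))"
  have S: "finite S" "S \<noteq> {}"
    using N(1) by (auto simp: S_def PiE_eq_empty_iff intro!: finite_PiE)
  have pts: "x s \<in> G_pts r" for s
    by (cases s) (auto simp: x_def G_pts_def torus_pts_def norm_power \<zeta>)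
  have ev0: "char_eval r \<gamma> (x s) \<noteq> 0" for s
    by (cases s) (simp add: char_eval_def x_def \<gamma>_eq characters_nonzero[OF \<chi>\<^sub>0] \<zeta>)
  \<comment> \<open>This is the indicator function of the coset of \<open>\<gamma>\<close>, up to a constant factor.\<close>
  define p where "p \<delta> = (\<Sum>s\<in>S. inverse (char_eval r \<gamma> (x s)) * char_eval r \<delta> (x s))" for \<delta>
  have "p \<gamma> = of_nat (card S)"
    by (simp add: p_def ev0)
  then have "p \<gamma> \<noteq> 0"
    using S by simp
  then have "\<exists>\<delta>\<in>K. p \<delta> \<noteq> 0"
    using strictly_pdD[OF spd S(1) _ _ \<gamma>, of x "\<lambda>s. inverse (char_eval r \<gamma> (x s))"] pts
    unfolding p_def by blast
  then obtain \<chi> m where \<delta>: "(\<chi>, m) \<in> K" "p (\<chi>, m) \<noteq> 0"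
    by auto
  have \<chi>: "\<chi> \<in> characters" and m: "\<forall>i\<ge>r. m i = 0"
    using \<delta>(1) K by auto
  \<comment> \<open>\<open>\<psi>\<close> is the \<open>F\<close>-component of the quotient of
    \<open>(\<chi>, m)\<close> by \<open>\<gamma>\<close>, and \<open>y j\<close> is the value of
    its \<open>j\<close>-th torus component at \<open>\<zeta>\<close>.\<close>
  define \<psi> where "\<psi> f = inverse (\<chi>\<^sub>0 f) * \<chi> f" for f
  define y where "y j = \<zeta> powi (m j - m\<^sub>0 j)" for j
  have \<psi>: "\<psi> \<in> characters"
    unfolding \<psi>_def by (intro characters_mult characters_inverse \<chi>\<^sub>0 \<chi>)
  have y: "y j ^ N = 1" for j
  proof -
    have "y j ^ N = (\<zeta> powi (m j - m\<^sub>0 j)) powi int N"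
      by (simp add: y_def)
    also have "\<dots> = (\<zeta> powi int N) powi (m j - m\<^sub>0 j)"
      by (simp only: power_int_mult[symmetric] mult.commute)
    finally show ?thesis
      by (simp add: \<zeta>)
  qed
  have "inverse (char_eval r \<gamma> (x (f, w))) * char_eval r (\<chi>, m) (x (f, w)) = \<psi> f * (\<Prod>j<r. y j ^ w j)"
    for f w
  proof -
    have "inverse ((\<zeta> ^ w j) powi m\<^sub>0 j) * (\<zeta> ^ w j) powi m j = y j ^ w j" for j
    proof -
      have "y j ^ w j = (\<zeta> powi int (w j)) powi (m j - m\<^sub>0 j)"
        unfolding y_def power_int_of_nat[symmetric] by (simp only: power_int_mult[symmetric] mult.commute)
      then show ?thesis
        using \<zeta>(1) by (simp add: power_int_diff field_simps)
    qed
    then show ?thesis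
      by (simp add: char_eval_def x_def \<gamma>_eq \<psi>_def mult_ac flip: prod_inversef prod.distrib)
  qed
  then have "p (\<chi>, m) = (\<Sum>(f, w)\<in>S. \<psi> f * (\<Prod>j<r. y j ^ w j))"
    unfolding p_def by (intro sum.cong) auto
  also have "\<dots> = (\<Sum>f\<in>UNIV. \<psi> f) * (\<Sum>w\<in>{..<r} \<rightarrow>\<^sub>E {..<N}. \<Prod>j<r. y j ^ w j)"
    unfolding S_def by (simp add: sum_product sum.cartesian_product)
  also have "\<dots> = (\<Sum>f\<in>UNIV. \<psi> f) * (\<Prod>j<r. \<Sum>w<N. y j ^ w)"
    by (subst prod_sum_PiE) auto
  finally have "(\<Sum>f\<in>UNIV. \<psi> f) \<noteq> 0" and y0: "\<And>j. j < r \<Longrightarrow> (\<Sum>w<N. y j ^ w) \<noteq> 0"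
    using \<delta>(2) by auto
  then have "\<psi> f = 1" for f
    using sum_character_eq_0[OF \<psi>] by blast
  then have "\<chi> = \<chi>\<^sub>0"
    using characters_nonzero[OF \<chi>\<^sub>0] by (auto simp: \<psi>_def field_simps)
  have "y j = 1" if "j < r" for j
    using sum_powers_root_of_unity_eq_0[OF y] y0[OF that] by blast
  \<comment> \<open>For \<open>j \<ge> r\<close> both exponents are 0, so only \<open>j < r\<close>
    needs the primitivity of \<open>\<zeta>\<close>.\<close>
  then have "int N dvd m j - m\<^sub>0 j" for j
    using cis_powi_eq_1D[OF N(1), folded \<zeta>_def, of "m j - m\<^sub>0 j"] m m\<^sub>0
    by (cases "j < r") (auto simp: y_def)
  then have "((\<lambda>_. 1), (\<lambda>j. m j - m\<^sub>0 j)) \<in> H"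
    using N(2) m m\<^sub>0 by (auto simp: congruence_subgroup_def)
  then have "(\<chi>, m) \<in> \<gamma> <#\<^bsub>dual_group r\<^esub> H"
    unfolding \<gamma>_eq \<open>\<chi> = \<chi>\<^sub>0\<close> by (force simp: l_coset_def)
  then show "(\<gamma> <#\<^bsub>dual_group r\<^esub> H) \<inter> K \<noteq> {}"
    using \<delta>(1) by blast
qed

theorem theorem1p1:
  fixes r :: nat
    and K :: "(('f::{ab_group_add, finite} \<Rightarrow> complex) \<times> (nat \<Rightarrow> int)) set"
  assumes "K \<subseteq> dual_carrier r"
  shows "strictly_pd r K \<longleftrightarrow> ubiquitous r K"
  using strictly_pd_imp_ubiquitous[OF assms] ubiquitous_imp_strictly_pd by blast

end
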